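(* Let $\lambda/\mu$ be a skew partition and $i$ a positive integer. For every semistandard tableau $T$ of shape $\lambda/\mu$, we have $\mathbf{BK}_i(T)=\mathbf B_i(T)$, where $\mathbf{BK}_i$ is the $i$-th (classical) Bender-Knuth involution and $\mathbf B_i$ is the generalized Bender-Knuth involution on reverse plane partitions of shape $\lambda/\mu$.
   Context: A partition $\lambda$ is identified with its Young diagram $\{(i,j)\in\mathbb N_+^2\mid j\le\lambda_i\}$ ($i$ is the row, growing downwards; $j$ is the column). A skew partition $\lambda/\mu$ is a pair of partitions with $\mu\subseteq\lambda$, also identified with the set difference of the diagrams. A reverse plane partition (rpp) of shape $\lambda/\mu$ is a map $T:\lambda/\mu\to\mathbb N_+$ weakly increasing left to right along rows and top to bottom down columns; it is a semistandard tableau if it is strictly increasing down columns. Definition of $\mathbf{BK}_i$. Let $T$ be a semistandard tableau of shape $\lambda/\mu$. If a column contains both an $i$ and an $i+1$, mark these entries as "ignored". In each row, the entries equal to $i$ or $i+1$ form a contiguous string consisting of $a$ ignored $i$'s, then $r$ non-ignored $i$'s, then $s$ non-ignored $(i+1)$'s, then $b$ ignored $(i+1)$'s (for some $a,r,s,b\ge0$). Replace the middle part ($r$ $i$'s followed by $s$ $(i+1)$'s) by $s$ $i$'s followed by $r$ $(i+1)$'s. Doing this in every row yields the semistandard tableau $\mathbf{BK}_i(T)$. Definition of $\mathbf B$. Fix a skew shape $D$ (the diagram of a skew partition). A 12-table is a map $T:D\to\{1,2\}$ weakly increasing down columns; a 12-rpp is a 12-table that is also weakly increasing along rows. A column is 1-pure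 (2-pure) if it is nonempty and all its entries are 1 (resp. 2), mixed if it contains both 1's and 2's. If column $k$ of $T$ is mixed, $\operatorname{sep}_kT$ is the smallest $r$ with $(r,k)\in D$, $T(r,k)=2$. A 12-table is benign if the values $\operatorname{sep}_kT$, listed over all mixed columns $k$ in increasing order of $k$, are weakly decreasing. $\operatorname{flip}(T)$ is obtained from $T$ by making every 1-pure column 2-pure and every 2-pure column 1-pure, leaving other columns unchanged. A descent of $T$ is a $k\ge 1$ such that for some $r$ the cells $(r,k),(r,k+1)$ lie in $D$ and $T(r,k)=2$, $T(r,k+1)=1$. If $k$ is a descent of a benign 12-table $P$, then exactly one of the following holds, and $\operatorname{res}_kP$ is the benign 12-table differing from $P$ only in columns $k,k+1$ and defined by: (M1) column $k$ of $P$ mixed, column $k+1$ 1-pure: in $\operatorname{res}_kP$ column $k$ is 1-pure and column $k+1$ is mixed with $\operatorname{sep}_{k+1}(\operatorname{res}_kP)=\operatorname{sep}_kP$; (2M) column $k$ 2-pure, column $k+1$ mixed: in $\operatorname{res}_kP$ column $k$ is mixed with $\operatorname{sep}_k(\operatorname{res}_kP)=\operatorname{sep}_{k+1}P$ and column $k+1$ is 2-pure; (21) column $k$ 2-pure, column $k+1$ 1-pure: in $\operatorname{res}_kP$ column $k$ is 1-pure and column $k+1$ is 2-pure. For every benign 12-table $P$ there is a unique 12-rpp, denoted $\operatorname{norm}(P)$, obtainable from $P$ by a finite (possibly empty) sequence of descent resolutions $P\mapsto\operatorname{res}_kP$. For a 12-rpp $T$ (always benign, as is $\operatorname{flip}(T)$),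 $\mathbf B(T):=\operatorname{norm}(\operatorname{flip}(T))$. Definition of $\mathbf B_i$. For an rpp $T$ of shape $\lambda/\mu$: restrict $T$ to the cells with entries $i$ or $i+1$ (these cells form a skew shape $D$), replace $i$ by 1 and $i+1$ by 2 to get a 12-rpp $T'$ of shape $D$, replace $T'$ by $\mathbf B(T')$, replace 1 by $i$ and 2 by $i+1$, and restore all other entries of $T$. The result is the rpp $\mathbf B_i(T)$ of shape $\lambda/\mu$. *)

theory Defs
  imports "HOL-Library.FuncSet"
begin

section \<open>Partitions, skew diagrams and tableaux\<close>

text \<open>A partition is a sequence \<open>\<lambda>\<^sub>1, \<lambda>\<^sub>2, \<dots>\<close>, given as a function on \<^typ>\<open>nat\<close> whose value at \<open>0\<close> is
  irrelevant. Cells are pairs (row, column), both numbered from \<open>1\<close>.\<close>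

definition partition :: "(nat \<Rightarrow> nat) \<Rightarrow> bool" where
  "partition lam \<longleftrightarrow>
     (\<forall>i j. 1 \<le> i \<and> i \<le> j \<longrightarrow> lam j \<le> lam i) \<and> finite {i. 1 \<le> i \<and> lam i \<noteq> 0}"

definition diagram :: "(nat \<Rightarrow> nat) \<Rightarrow> (nat \<times> nat) set" where
  "diagram lam = {(i, j). 1 \<le> i \<and> 1 \<le> j \<and> j \<le> lam i}"

definition skew_partition :: "(nat \<Rightarrow> nat) \<Rightarrow> (nat \<Rightarrow> nat) \<Rightarrow> bool" where
  "skew_partition lam mu \<longleftrightarrow> partition lam \<and> partition mu \<and> diagram mu \<subseteq> diagram lam"

definition skew_diagram :: "(nat \<Rightarrow> nat) \<Rightarrow> (nat \<Rightarrow> nat) \<Rightarrow> (nat \<times> nat) set" where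
  "skew_diagram lam mu = diagram lam - diagram mu"

text \<open>Fillings of a shape \<open>D\<close> are extensional functions (\<^const>\<open>undefined\<close> outside \<open>D\<close>), so that
  equality of functions is equality of fillings.\<close>

definition rows_weak :: "(nat \<times> nat) set \<Rightarrow> (nat \<times> nat \<Rightarrow> nat) \<Rightarrow> bool" where
  "rows_weak D T \<longleftrightarrow>
     (\<forall>r c c'. (r, c) \<in> D \<and> (r, c') \<in> D \<and> c \<le> c' \<longrightarrow> T (r, c) \<le> T (r, c'))"

definition columns_weak :: "(nat \<times> nat) set \<Rightarrow> (nat \<times> nat \<Rightarrow> nat) \<Rightarrow> bool" where
  "columns_weak D T \<longleftrightarrow>
     (\<forall>r r' c. (r, c) \<in> D \<and> (r', c) \<in> D \<and> r \<le> r' \<longrightarrow> T (r, c) \<le> T (r', c))"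

definition columns_strict :: "(nat \<times> nat) set \<Rightarrow> (nat \<times> nat \<Rightarrow> nat) \<Rightarrow> bool" where
  "columns_strict D T \<longleftrightarrow>
     (\<forall>r r' c. (r, c) \<in> D \<and> (r', c) \<in> D \<and> r < r' \<longrightarrow> T (r, c) < T (r', c))"

definition rpp :: "(nat \<times> nat) set \<Rightarrow> (nat \<times> nat \<Rightarrow> nat) \<Rightarrow> bool" where
  "rpp D T \<longleftrightarrow> T \<in> D \<rightarrow>\<^sub>E {1..} \<and> rows_weak D T \<and> columns_weak D T"

definition semistandard :: "(nat \<times> nat) set \<Rightarrow> (nat \<times> nat \<Rightarrow> nat) \<Rightarrow> bool" where
  "semistandard D T \<longleftrightarrow> rpp D T \<and> columns_strict D T"


section \<open>The classical Bender-Knuth involution\<close>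

definition ignored :: "(nat \<times> nat) set \<Rightarrow> nat \<Rightarrow> (nat \<times> nat \<Rightarrow> nat) \<Rightarrow> nat \<times> nat \<Rightarrow> bool" where
  "ignored D i T = (\<lambda>(r, c). (r, c) \<in> D \<and> T (r, c) \<in> {i, i + 1} \<and>
     (\<exists>r'. (r', c) \<in> D \<and> T (r', c) = i) \<and> (\<exists>r'. (r', c) \<in> D \<and> T (r', c) = i + 1))"

text \<open>\<open>free_columns D i T r v\<close> is the set of columns of the non-ignored entries \<open>v\<close> of row \<open>r\<close>;
  it is used for \<open>v = i\<close> and \<open>v = i + 1\<close>.\<close>

definition free_columns ::
  "(nat \<times> nat) set \<Rightarrow> nat \<Rightarrow> (nat \<times> nat \<Rightarrow> nat) \<Rightarrow> nat \<Rightarrow> nat \<Rightarrow> nat set" where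
  "free_columns D i T r v = {c. (r, c) \<in> D \<and> T (r, c) = v \<and> \<not> ignored D i T (r, c)}"

text \<open>With \<open>s\<close> the number of non-ignored entries \<open>i + 1\<close> of row \<open>r\<close>, the first \<open>s\<close> cells from the left
  of the non-ignored part \<open>M\<close> of that row receive \<open>i\<close>, the remaining ones \<open>i + 1\<close>.\<close>

definition BK :: "(nat \<times> nat) set \<Rightarrow> nat \<Rightarrow> (nat \<times> nat \<Rightarrow> nat) \<Rightarrow> (nat \<times> nat \<Rightarrow> nat)" where
  "BK D i T = (\<lambda>(r, c).
     let M = free_columns D i T r i \<union> free_columns D i T r (i + 1);
         s = card (free_columns D i T r (i + 1))
     in if c \<in> M then (if card {c' \<in> M. c' < c} < s then i else i + 1) else T (r, c))"


section \<open>12-tables and descent resolution\<close>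

definition table12 :: "(nat \<times> nat) set \<Rightarrow> (nat \<times> nat \<Rightarrow> nat) \<Rightarrow> bool" where
  "table12 D T \<longleftrightarrow> T \<in> D \<rightarrow>\<^sub>E {1, 2} \<and> columns_weak D T"

definition rpp12 :: "(nat \<times> nat) set \<Rightarrow> (nat \<times> nat \<Rightarrow> nat) \<Rightarrow> bool" where
  "rpp12 D T \<longleftrightarrow> table12 D T \<and> rows_weak D T"

definition pure :: "(nat \<times> nat) set \<Rightarrow> (nat \<times> nat \<Rightarrow> nat) \<Rightarrow> nat \<Rightarrow> nat \<Rightarrow> bool" where
  "pure D T v k \<longleftrightarrow> (\<exists>r. (r, k) \<in> D) \<and> (\<forall>r. (r, k) \<in> D \<longrightarrow> T (r, k) = v)"

definition mixed :: "(nat \<times> nat) set \<Rightarrow> (nat \<times> nat \<Rightarrow> nat) \<Rightarrow> nat \<Rightarrow> bool" where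
  "mixed D T k \<longleftrightarrow> (\<exists>r. (r, k) \<in> D \<and> T (r, k) = 1) \<and> (\<exists>r. (r, k) \<in> D \<and> T (r, k) = 2)"

definition sep :: "(nat \<times> nat) set \<Rightarrow> (nat \<times> nat \<Rightarrow> nat) \<Rightarrow> nat \<Rightarrow> nat" where
  "sep D T k = (LEAST r. (r, k) \<in> D \<and> T (r, k) = 2)"

definition benign :: "(nat \<times> nat) set \<Rightarrow> (nat \<times> nat \<Rightarrow> nat) \<Rightarrow> bool" where
  "benign D T \<longleftrightarrow> table12 D T \<and>
     (\<forall>k l. k < l \<and> mixed D T k \<and> mixed D T l \<longrightarrow> sep D T l \<le> sep D T k)"

definition flip :: "(nat \<times> nat) set \<Rightarrow> (nat \<times> nat \<Rightarrow> nat) \<Rightarrow> (nat \<times> nat \<Rightarrow> nat)" where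
  "flip D T = (\<lambda>(r, k)\<in>D. if pure D T 1 k then 2 else if pure D T 2 k then 1 else T (r, k))"

definition descent :: "(nat \<times> nat) set \<Rightarrow> (nat \<times> nat \<Rightarrow> nat) \<Rightarrow> nat \<Rightarrow> bool" where
  "descent D T k \<longleftrightarrow> 1 \<le> k \<and>
     (\<exists>r. (r, k) \<in> D \<and> (r, k + 1) \<in> D \<and> T (r, k) = 2 \<and> T (r, k + 1) = 1)"

text \<open>\<open>is_res D k P Q\<close> says that \<open>k\<close> is a descent of the benign 12-table \<open>P\<close> and \<open>Q = res\<^sub>k P\<close>; the
  three disjuncts are the cases (M1), (2M) and (21). The conditions determine \<open>Q\<close> because a
  mixed column of a 12-table is determined by its \<^const>\<open>sep\<close> value.\<close>

definition is_res ::
  "(nat \<times> nat) set \<Rightarrow> nat \<Rightarrow> (nat \<times> nat \<Rightarrow> nat) \<Rightarrow> (nat \<times> nat \<Rightarrow> nat) \<Rightarrow> bool" where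
  "is_res D k P Q \<longleftrightarrow>
     benign D P \<and> descent D P k \<and> benign D Q \<and>
     (\<forall>r c. (r, c) \<in> D \<and> c \<noteq> k \<and> c \<noteq> k + 1 \<longrightarrow> Q (r, c) = P (r, c)) \<and>
     (mixed D P k \<and> pure D P 1 (k + 1) \<and>
        pure D Q 1 k \<and> mixed D Q (k + 1) \<and> sep D Q (k + 1) = sep D P k
      \<or> pure D P 2 k \<and> mixed D P (k + 1) \<and>
        mixed D Q k \<and> sep D Q k = sep D P (k + 1) \<and> pure D Q 2 (k + 1)
      \<or> pure D P 2 k \<and> pure D P 1 (k + 1) \<and>
        pure D Q 1 k \<and> pure D Q 2 (k + 1))"

definition norm12 :: "(nat \<times> nat) set \<Rightarrow> (nat \<times> nat \<Rightarrow> nat) \<Rightarrow> (nat \<times> nat \<Rightarrow> nat)" where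
  "norm12 D P = (THE Q. rpp12 D Q \<and> (\<lambda>A B. \<exists>k. is_res D k A B)\<^sup>*\<^sup>* P Q)"

definition B12 :: "(nat \<times> nat) set \<Rightarrow> (nat \<times> nat \<Rightarrow> nat) \<Rightarrow> (nat \<times> nat \<Rightarrow> nat)" where
  "B12 D T = norm12 D (flip D T)"


section \<open>The generalized Bender-Knuth involution\<close>

definition GBK :: "(nat \<times> nat) set \<Rightarrow> nat \<Rightarrow> (nat \<times> nat \<Rightarrow> nat) \<Rightarrow> (nat \<times> nat \<Rightarrow> nat)" where
  "GBK D i T =
     (let E = {x \<in> D. T x \<in> {i, i + 1}};
          U = B12 E (\<lambda>x\<in>E. if T x = i then 1 else 2)
      in (\<lambda>x. if x \<in> E then (if U x = 1 then i else i + 1) else T x))"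

end

theory Submission
  imports Defs
begin

text \<open>In a semistandard tableau, a column meets the cells with entries \<open>i\<close>, \<open>i + 1\<close> either in a
  single cell or in one \<open>i\<close> and one \<open>i + 1\<close>. Hence after \<^const>\<open>flip\<close> the mixed columns are those of
  height two and never change, so only the resolution (21) ever applies. It swaps a \<open>2\<close> with the
  \<open>1\<close> to its right, which preserves the number of ones among the non-ignored cells of each row.
  A 12-rpp reached in this way is sorted along rows, so it is determined by these numbers, and they
  are the numbers prescribed by \<^const>\<open>BK\<close>.\<close>

section \<open>Two facts on linear orders\<close>

text \<open>The elements of \<open>M\<close> below \<open>c\<close> and those satisfying
  \<open>P\<close> both form initial segments of \<open>M\<close>, so comparing sizes decides
  whether the second reaches \<open>c\<close>. This links sortedness of a row to the counting rule
  of \<open>BK\<close>.\<close>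

lemma initial_segment_iff_card_less:
  fixes M :: "'a::linorder set"
  assumes fin: "finite M" and c: "c \<in> M"
    and down: "\<And>x y. x \<in> M \<Longrightarrow> y \<in> M \<Longrightarrow> x \<le> y \<Longrightarrow> P y \<Longrightarrow> P x"
  shows "P c \<longleftrightarrow> card {x \<in> M. x < c} < card {x \<in> M. P x}"
proof
  assume "P c"
  then have "{x \<in> M. x < c} \<subset> {x \<in> M. P x}"
    using down[OF _ c] c by auto
  then show "card {x \<in> M. x < c} < card {x \<in> M. P x}"
    using fin by (intro psubset_card_mono) auto
next
  assume less: "card {x \<in> M. x < c} < card {x \<in> M. P x}"
  show "P c"
  proof (rule ccontr)
    assume "\<not> P c"
    then have "{x \<in> M. P x} \<subseteq> {x \<in> M. x < c}"
      using down[OF c] by (auto simp: not_less[symmetric])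
    then have "card {x \<in> M. P x} \<le> card {x \<in> M. x < c}"
      using fin by (intro card_mono) auto
    with less show False by simp
  qed
qed

text \<open>A discrete intermediate value argument, used to turn an inversion between distant cells
  of a row into one between neighbours.\<close>

lemma nat_adjacent_change:
  fixes a b :: nat
  assumes "a < b" "P a" "\<not> P b"
  obtains k where "a \<le> k" "k < b" "P k" "\<not> P (Suc k)"
  using assms
proof (induction b arbitrary: thesis)
  case (Suc b)
  show ?case
  proof (cases "P b")
    case True
    then show ?thesis using Suc.prems by (intro Suc.prems(1)[of b]) auto
  next
    case False
    then have "a < b" using Suc.prems by (metis less_antisym)
    then show ?thesis
      using Suc.IH[of thesis] Suc.prems False by (metis less_SucI)
  qed
qed simp

section \<open>Setting and invariant\<close>

text \<open>\<open>convex\<close> is closure under intervals of the componentwise order, the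
  geometric property of skew shapes that drives the arguments. \<open>col_pos\<close> serves the
  clause \<open>1 \<le> k\<close> of \<open>descent\<close>.\<close>

locale convex_tableau =
  fixes D :: "(nat \<times> nat) set" and i :: nat and T :: "nat \<times> nat \<Rightarrow> nat"
  assumes semistd: "semistandard D T"
    and fin: "finite D"
    and convex: "\<lbrakk>(r, c) \<in> D; (r', c') \<in> D; r \<le> s; s \<le> r'; c \<le> d; d \<le> c'\<rbrakk> \<Longrightarrow> (s, d) \<in> D"
    and col_pos: "(r, c) \<in> D \<Longrightarrow> 1 \<le> c"
begin

text \<open>\<open>E\<close> and \<open>T12\<close> are the shape and the table that
  \<open>GBK\<close> passes to \<open>B12\<close>; \<open>free r\<close> below is the set
  \<open>M\<close> of \<open>BK\<close>.\<close>

definition E :: "(nat \<times> nat) set" where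
  "E = {x \<in> D. T x \<in> {i, i + 1}}"

definition T12 :: "nat \<times> nat \<Rightarrow> nat" where
  "T12 = (\<lambda>x\<in>E. if T x = i then 1 else 2)"

definition free :: "nat \<Rightarrow> nat set" where
  "free r = free_columns D i T r i \<union> free_columns D i T r (i + 1)"

text \<open>The invariant of resolution started at \<open>flip E T12\<close>. Ones are counted
  against the free entries \<open>i + 1\<close> of \<open>T\<close> because \<open>flip\<close>
  exchanges the two values on free cells.\<close>

definition admissible :: "(nat \<times> nat \<Rightarrow> nat) \<Rightarrow> bool" where
  "admissible Q \<longleftrightarrow> Q \<in> E \<rightarrow>\<^sub>E {1, 2} \<and> (\<forall>x. ignored D i T x \<longrightarrow> Q x = T12 x) \<and>
     (\<forall>r. card {c \<in> free r. Q (r, c) = 1} = card (free_columns D i T r (i + 1)))"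

lemma row_le: "\<lbrakk>(r, c) \<in> D; (r, c') \<in> D; c \<le> c'\<rbrakk> \<Longrightarrow> T (r, c) \<le> T (r, c')"
  using semistd unfolding semistandard_def rpp_def rows_weak_def by blast

lemma column_less: "\<lbrakk>(r, c) \<in> D; (r', c) \<in> D; r < r'\<rbrakk> \<Longrightarrow> T (r, c) < T (r', c)"
  using semistd unfolding semistandard_def columns_strict_def by blast

lemma E_iff: "x \<in> E \<longleftrightarrow> x \<in> D \<and> (T x = i \<or> T x = i + 1)"
  by (auto simp: E_def)

lemma finite_E: "finite E"
  using fin by (simp add: E_def)

lemma mem_free_iff: "c \<in> free r \<longleftrightarrow> (r, c) \<in> E \<and> \<not> ignored D i T (r, c)"
  by (auto simp: free_def free_columns_def E_iff)

lemma finite_free: "finite (free r)"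
proof (rule finite_subset)
  show "free r \<subseteq> snd ` E" by (force simp: mem_free_iff)
qed (use finite_E in simp)

lemma T12_ignored: "ignored D i T x \<Longrightarrow> T12 x = (if T x = i then 1 else 2)"
  by (auto simp: ignored_def T12_def E_iff)

lemma admissible_values: "\<lbrakk>admissible Q; x \<in> E\<rbrakk> \<Longrightarrow> Q x = 1 \<or> Q x = 2"
  unfolding admissible_def by blast

section \<open>Columns of the restricted tableau\<close>

text \<open>Strict columns leave room for only two cells when just two values are available.\<close>

lemma column_pair:
  assumes "(r, c) \<in> E" "(r', c) \<in> E" "r < r'"
  shows "T (r, c) = i" "T (r', c) = i + 1" "ignored D i T (r, c)" "ignored D i T (r', c)"
proof -
  have "T (r, c) < T (r', c)" using assms column_less by (simp add: E_iff)
  then show *: "T (r, c) = i" "T (r', c) = i + 1" using assms by (auto simp: E_iff)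
  then show "ignored D i T (r, c)" "ignored D i T (r', c)"
    using assms unfolding ignored_def E_iff by auto
qed

lemma column_distinct_ignored:
  assumes "(r, c) \<in> E" "(r', c) \<in> E" "r \<noteq> r'"
  shows "ignored D i T (r, c)"
  using column_pair(3)[of r c r'] column_pair(4)[of r' c r] assms
  by (cases r r' rule: linorder_cases) simp_all

lemma ignored_column:
  assumes "ignored D i T (r, c)"
  obtains a b where "a < b" "(a, c) \<in> E" "(b, c) \<in> E" "T (a, c) = i" "T (b, c) = i + 1"
    "ignored D i T (a, c)" "ignored D i T (b, c)" "r = a \<or> r = b"
proof -
  from assms obtain a b where ab: "(a, c) \<in> D" "T (a, c) = i" "(b, c) \<in> D" "T (b, c) = i + 1"
    and r: "(r, c) \<in> D" "T (r, c) = i \<or> T (r, c) = i + 1"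
    unfolding ignored_def by auto
  have "a < b" using column_less[of b c a] ab by (cases a b rule: linorder_cases) auto
  moreover have "r = a \<or> r = b"
    using column_less[of r c a] column_less[of a c r] column_less[of r c b] column_less[of b c r] ab r
    by (metis less_irrefl linorder_neqE_nat)
  moreover have E: "(a, c) \<in> E" "(b, c) \<in> E" using ab by (auto simp: E_iff)
  ultimately show thesis using that[of a b] ab column_pair[OF E] by blast
qed

lemma distinct_not_pure:
  "\<lbrakk>(a, c) \<in> E; (b, c) \<in> E; Q (a, c) \<noteq> Q (b, c)\<rbrakk> \<Longrightarrow> \<not> pure E Q v c"
  unfolding pure_def by blast

text \<open>A mixed column has two distinct cells, so \<open>column_pair\<close> applies.
  \<open>Q\<close> is arbitrary here, which permits use on the result of a resolution before that
  result is known to be admissible.\<close>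

lemma mixed_pair:
  assumes "mixed E Q c"
  obtains a b where "a < b" "(a, c) \<in> E" "(b, c) \<in> E"
    "ignored D i T (a, c)" "ignored D i T (b, c)"
proof -
  from assms obtain x y where xy: "(x, c) \<in> E" "(y, c) \<in> E" "Q (x, c) = 1" "Q (y, c) = 2"
    unfolding mixed_def by blast
  then have "x \<noteq> y" by auto
  with xy(1,2) show thesis
    using that[of x y] that[of y x] column_pair[of x c y] column_pair[of y c x]
    by (cases x y rule: linorder_cases) simp_all
qed

text \<open>On ignored cells \<open>Q\<close> still encodes \<open>T\<close>, so \<open>sep\<close>
  finds the row of the entry \<open>i + 1\<close> of \<open>T\<close>.\<close>

lemma admissible_mixed:
  assumes "admissible Q" "mixed E Q c"
  obtains a where "(a, c) \<in> E" "(sep E Q c, c) \<in> E" "T (a, c) = i" "T (sep E Q c, c) = i + 1"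
proof -
  from assms(2) obtain a b where ab: "a < b" "(a, c) \<in> E" "(b, c) \<in> E"
    "ignored D i T (a, c)" "ignored D i T (b, c)" by (rule mixed_pair)
  note T = column_pair(1,2)[OF ab(2,3,1)]
  have Q: "Q (a, c) = 1" "Q (b, c) = 2"
    using assms(1) ab T T12_ignored unfolding admissible_def by auto
  have only: "r = b" if "(r, c) \<in> E" "Q (r, c) = 2" for r
    using that column_pair[of r c b] column_pair[of b c r] ab T assms(1)
    by (cases r b rule: linorder_cases) (auto simp: admissible_def T12_ignored)
  have "sep E Q c = b"
    unfolding sep_def
  proof (rule Least_equality)
    show "(b, c) \<in> E \<and> Q (b, c) = 2" using ab Q by blast
    show "b \<le> r" if "(r, c) \<in> E \<and> Q (r, c) = 2" for r
      using only[of r] that by simp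
  qed
  then show thesis using that ab T by blast
qed

text \<open>The column of an ignored cell keeps the 1 and the 2 of \<open>T12\<close>. With
  \<open>mixed_pair\<close> this makes the mixed columns the same for all admissible tables.\<close>

lemma admissible_not_pure:
  assumes "admissible Q" "ignored D i T (r, c)"
  shows "\<not> pure E Q v c"
proof -
  from assms(2) obtain a b where "a < b" "(a, c) \<in> E" "(b, c) \<in> E"
    "T (a, c) = i" "T (b, c) = i + 1" "ignored D i T (a, c)" "ignored D i T (b, c)"
    by (rule ignored_column)
  with assms(1) have "Q (a, c) = 1" "Q (b, c) = 2"
    unfolding admissible_def by (auto simp: T12_ignored)
  then have "Q (a, c) \<noteq> Q (b, c)" by simp
  with \<open>(a, c) \<in> E\<close> \<open>(b, c) \<in> E\<close> show ?thesis by (intro distinct_not_pure[of a c b Q])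
qed

lemma not_ignored_unique:
  "\<lbrakk>(r, c) \<in> E; \<not> ignored D i T (r, c); (s, c) \<in> E\<rbrakk> \<Longrightarrow> s = r"
  using column_distinct_ignored[of r c s] by blast

lemma pure_not_ignored:
  assumes "(r, c) \<in> E" "\<not> ignored D i T (r, c)"
  shows "pure E Q v c \<longleftrightarrow> Q (r, c) = v"
  using assms not_ignored_unique[OF assms] unfolding pure_def by blast

lemma admissible_table12:
  assumes "admissible Q"
  shows "table12 E Q"
  unfolding table12_def columns_weak_def
proof (intro conjI allI impI; (elim conjE)?)
  show "Q \<in> E \<rightarrow>\<^sub>E {1, 2}" using assms by (simp add: admissible_def)
  fix r r' c assume rc: "(r, c) \<in> E" "(r', c) \<in> E" "r \<le> r'"
  show "Q (r, c) \<le> Q (r', c)"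
  proof (cases "r = r'")
    case False
    with rc have "r < r'" by simp
    note * = column_pair[OF rc(1,2) this]
    then show ?thesis using assms by (simp add: admissible_def T12_ignored)
  qed simp
qed

text \<open>The \<open>sep\<close> values are rows of entries \<open>i + 1\<close> of
  \<open>T\<close>. If they increased from column \<open>k\<close> to column \<open>l\<close>,
  convexity would supply the cell in the upper row of column \<open>l\<close>; its entry would be at
  least \<open>i + 1\<close>, yet smaller than the \<open>i + 1\<close> below it.\<close>

lemma admissible_benign:
  assumes "admissible Q"
  shows "benign E Q"
  unfolding benign_def
proof (intro conjI allI impI; (elim conjE)?)
  show "table12 E Q" using assms by (rule admissible_table12)
  fix k l assume kl: "k < l" and mixed: "mixed E Q k" "mixed E Q l"
  let ?b = "sep E Q k" and ?d = "sep E Q l"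
  have b: "(?b, k) \<in> D" "T (?b, k) = i + 1" and d: "(?d, l) \<in> D" "T (?d, l) = i + 1"
    using admissible_mixed[OF assms mixed(1)] admissible_mixed[OF assms mixed(2)]
    by (auto simp: E_iff)
  show "?d \<le> ?b"
  proof (rule ccontr)
    assume "\<not> ?d \<le> ?b"
    then have bd: "?b < ?d" by simp
    then have bl: "(?b, l) \<in> D" using convex[OF b(1) d(1), of ?b l] kl by simp
    then have "T (?b, k) \<le> T (?b, l)" "T (?b, l) < T (?d, l)"
      using row_le[OF b(1) bl] column_less[OF bl d(1) bd] kl by simp_all
    then show False using b d by simp
  qed
qed

section \<open>Start and steps of the resolution\<close>

text \<open>A free cell is alone in its column, so \<open>flip\<close> exchanges 1 and 2 there;
  columns with ignored cells are not pure, so \<open>flip\<close> leaves them alone.\<close>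

lemma admissible_T12_flip: "admissible (flip E T12)"
  unfolding admissible_def
proof (intro conjI allI impI)
  have T12_E: "T12 x = 1 \<or> T12 x = 2" if "x \<in> E" for x
    using that by (simp add: T12_def)
  show "flip E T12 \<in> E \<rightarrow>\<^sub>E {1, 2}"
    using T12_E by (fastforce simp: flip_def split: if_splits)
  show "flip E T12 x = T12 x" if ign: "ignored D i T x" for x
  proof -
    obtain r c where x: "x = (r, c)" by force
    from ign[unfolded x] obtain a b where "a < b" "(a, c) \<in> E" "(b, c) \<in> E"
      "T (a, c) = i" "T (b, c) = i + 1" "r = a \<or> r = b"
      by (rule ignored_column)
    then have *: "(a, c) \<in> E" "(b, c) \<in> E" "T12 (a, c) \<noteq> T12 (b, c)" and "(r, c) \<in> E"
      by (auto simp: T12_def)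
    then show ?thesis using distinct_not_pure[OF *] by (simp add: flip_def x)
  qed
  show "card {c \<in> free r. flip E T12 (r, c) = 1} = card (free_columns D i T r (i + 1))" for r
  proof -
    have *: "flip E T12 (r, c) = 1 \<longleftrightarrow> T (r, c) = i + 1" if "c \<in> free r" for c
    proof -
      have rc: "(r, c) \<in> E" "\<not> ignored D i T (r, c)" using that by (auto simp: mem_free_iff)
      then have "pure E T12 v c \<longleftrightarrow> T12 (r, c) = v" for v
        by (rule pure_not_ignored)
      with rc(1) have "flip E T12 (r, c) = (if T12 (r, c) = 1 then 2 else 1)"
        using T12_E[of "(r, c)"] by (auto simp: flip_def)
      moreover have "T12 (r, c) = (if T (r, c) = i then 1 else 2)"
        using rc(1) by (simp add: T12_def)
      ultimately show ?thesis using rc(1) by (auto simp: E_iff)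
    qed
    then have "{c \<in> free r. flip E T12 (r, c) = 1} = {c \<in> free r. T (r, c) = i + 1}" by blast
    also have "\<dots> = free_columns D i T r (i + 1)" by (auto simp: free_def free_columns_def)
    finally show ?thesis by simp
  qed
qed

text \<open>(M1) and (2M) would turn a pure column into a mixed one.\<close>

lemma is_res_swap:
  assumes adm: "admissible P" and res: "is_res E k P Q"
  obtains r where "(r, k) \<in> E" "(r, k + 1) \<in> E" "\<not> ignored D i T (r, k)"
    "\<not> ignored D i T (r, k + 1)" "P (r, k) = 2" "P (r, k + 1) = 1"
    "Q = P((r, k) := 1, (r, k + 1) := 2)"
proof -
  have "\<not> (pure E P v c \<and> mixed E Q c)" for v c
    using admissible_not_pure[OF adm] mixed_pair[of Q c] by metis
  with res have P: "pure E P 2 k" "pure E P 1 (k + 1)" and Q: "pure E Q 1 k" "pure E Q 2 (k + 1)"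
    and other: "\<And>r c. (r, c) \<in> E \<Longrightarrow> c \<noteq> k \<Longrightarrow> c \<noteq> k + 1 \<Longrightarrow> Q (r, c) = P (r, c)"
    and desc: "descent E P k" and "benign E Q"
    unfolding is_res_def by blast+
  then have Q_ext: "Q \<in> extensional E" and P_ext: "P \<in> extensional E"
    using adm unfolding benign_def table12_def admissible_def by (auto simp: PiE_def)
  from desc obtain r where r: "(r, k) \<in> E" "(r, k + 1) \<in> E" "P (r, k) = 2" "P (r, k + 1) = 1"
    unfolding descent_def by blast
  have nign: "\<not> ignored D i T (r, k)" "\<not> ignored D i T (r, k + 1)"
    using admissible_not_pure[OF adm] P by blast+
  then have single: "s = r" if "(s, c) \<in> E" "c = k \<or> c = k + 1" for s c
    using that not_ignored_unique r nign by blast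
  have Qr: "Q (r, k) = 1" "Q (r, k + 1) = 2" using Q r unfolding pure_def by blast+
  have "Q = P((r, k) := 1, (r, k + 1) := 2)"
  proof (rule ext)
    fix x :: "nat \<times> nat"
    obtain s c where x: "x = (s, c)" by force
    show "Q x = (P((r, k) := 1, (r, k + 1) := 2)) x"
    proof (cases "(s, c) \<in> E")
      case True
      consider "c = k" "s = r" | "c = k + 1" "s = r" | "c \<noteq> k" "c \<noteq> k + 1"
        using single[OF True] by blast
      then show ?thesis by cases (simp_all add: x Qr[simplified] other[OF True])
    next
      case False
      then have "Q x = P x" using Q_ext P_ext by (simp add: x extensional_def)
      moreover have "x \<noteq> (r, k)" "x \<noteq> (r, k + 1)" using False r x by blast+
      ultimately show ?thesis by simp
    qed
  qed
  then show thesis by (rule that[OF r(1,2) nign r(3,4)])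
qed

text \<open>The swap moves a 1 between two free cells of the same row, so row counts and ignored
  cells are unaffected.\<close>

lemma admissible_swap:
  assumes adm: "admissible P"
    and r: "(r, k) \<in> E" "(r, k + 1) \<in> E" "\<not> ignored D i T (r, k)"
      "\<not> ignored D i T (r, k + 1)" "P (r, k) = 2" "P (r, k + 1) = 1"
  shows "admissible (P((r, k) := 1, (r, k + 1) := 2))" (is "admissible ?Q")
  unfolding admissible_def
proof (intro conjI allI impI)
  show "?Q \<in> E \<rightarrow>\<^sub>E {1, 2}"
  proof (rule PiE_I)
    show "?Q x \<in> {1, 2}" if "x \<in> E" for x using admissible_values[OF adm that] by auto
    have "P \<in> E \<rightarrow>\<^sub>E {1, 2}" using adm by (simp add: admissible_def)
    then show "?Q x = undefined" if "x \<notin> E" for x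
      using that r(1,2) PiE_arb[of P E _ x] by auto
  qed
  show "?Q x = T12 x" if "ignored D i T x" for x
  proof -
    have "x \<noteq> (r, k)" "x \<noteq> (r, k + 1)" using that r(3,4) by blast+
    moreover have "P x = T12 x" using that adm unfolding admissible_def by blast
    ultimately show ?thesis by simp
  qed
  show "card {c \<in> free s. ?Q (s, c) = 1} = card (free_columns D i T s (i + 1))" for s
  proof -
    let ?A = "{c \<in> free s. P (s, c) = 1}"
    have "card {c \<in> free s. ?Q (s, c) = 1} = card ?A"
    proof (cases "s = r")
      case True
      have "{c \<in> free s. ?Q (s, c) = 1} = insert k (?A - {k + 1})"
        using r True by (auto simp: mem_free_iff)
      moreover have "card (insert k (?A - {k + 1})) = Suc (card (?A - {k + 1}))"
        using finite_free r(5) True by (intro card_insert_disjoint) auto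
      moreover have "Suc (card (?A - {k + 1})) = card ?A"
        using r True by (intro card_Suc_Diff1) (simp_all add: finite_free, simp add: mem_free_iff)
      ultimately show ?thesis by (simp only:)
    qed simp
    then show ?thesis using adm by (simp add: admissible_def)
  qed
qed

lemma admissible_is_res:
  assumes "admissible P" "is_res E k P Q"
  shows "admissible Q"
proof -
  from assms obtain r where r: "(r, k) \<in> E" "(r, k + 1) \<in> E" "\<not> ignored D i T (r, k)"
    "\<not> ignored D i T (r, k + 1)" "P (r, k) = 2" "P (r, k + 1) = 1"
    and Q: "Q = P((r, k) := 1, (r, k + 1) := 2)"
    by (rule is_res_swap)
  show ?thesis unfolding Q by (rule admissible_swap[OF assms(1) r])
qed

lemma admissible_reachable:
  assumes "(\<lambda>A B. \<exists>k. is_res E k A B)\<^sup>*\<^sup>* P Q" "admissible P"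
  shows "admissible Q"
  using assms(1)
proof (induction rule: rtranclp_induct)
  case base
  show ?case by (rule assms(2))
next
  case (step Q R)
  then show ?case by (elim exE) (rule admissible_is_res)
qed

text \<open>If the cell with the \<open>2\<close> is ignored, then the right neighbour of the \<open>i\<close> above it lies in \<open>D\<close>
  by convexity and must be an \<open>i\<close>, so the cell with the \<open>1\<close> is ignored, too; the converse is
  symmetric. But ignored cells still have their entries from \<open>T\<close>, which increase along rows.\<close>

lemma descent_not_ignored:
  assumes adm: "admissible Q" and E: "(r, k) \<in> E" "(r, k + 1) \<in> E"
    and Q: "Q (r, k) = 2" "Q (r, k + 1) = 1"
  shows "\<not> ignored D i T (r, k)" "\<not> ignored D i T (r, k + 1)"
proof -
  have ign: "Q x = (if T x = i then 1 else 2)" if "ignored D i T x" for x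
    using T12_ignored[OF that] that adm unfolding admissible_def by metis
  have row: "T (r, k) \<le> T (r, k + 1)" using row_le[of r k "k + 1"] E by (simp add: E_iff)
  \<comment> \<open>Assuming the disjunction loses nothing, since the equivalence is trivial when
    both sides fail.\<close>
  have iff: "ignored D i T (r, k) \<longleftrightarrow> ignored D i T (r, k + 1)"
    if "ignored D i T (r, k) \<or> ignored D i T (r, k + 1)"
    using that
  proof
    assume k: "ignored D i T (r, k)"
    then have Tr: "T (r, k) = i + 1"
      using ign Q E by (auto simp: E_iff split: if_splits)
    from k obtain a b where a: "a < b" "(a, k) \<in> E" "(b, k) \<in> E" "T (a, k) = i" "r = a \<or> r = b"
      by (rule ignored_column)
    then have ar: "a < r" using Tr by auto
    then have ak: "(a, k + 1) \<in> D"
      using convex[of a k r "k + 1" a "k + 1"] a E by (simp add: E_iff)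
    have "T (a, k) \<le> T (a, k + 1)" "T (a, k + 1) < T (r, k + 1)"
      using row_le[of a k "k + 1"] column_less[of a "k + 1" r] ak ar a E by (simp_all add: E_iff)
    then have "(a, k + 1) \<in> E" using a ak E by (auto simp: E_iff)
    then show ?thesis using k column_distinct_ignored E ar by blast
  next
    assume k: "ignored D i T (r, k + 1)"
    then have Tr: "T (r, k + 1) = i"
      using ign Q E by (auto simp: E_iff split: if_splits)
    from k obtain a b where a: "a < b" "(a, k + 1) \<in> E" "(b, k + 1) \<in> E"
      "T (b, k + 1) = i + 1" "r = a \<or> r = b"
      by (rule ignored_column)
    then have br: "r < b" using Tr by auto
    then have bk: "(b, k) \<in> D"
      using convex[of r k b "k + 1" b k] a E by (simp add: E_iff)
    have "T (b, k) \<le> T (b, k + 1)" "T (r, k) < T (b, k)"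
      using row_le[of b k "k + 1"] column_less[of r k b] bk br a E by (simp_all add: E_iff)
    then have "(b, k) \<in> E" using a bk E by (auto simp: E_iff)
    then show ?thesis using k column_distinct_ignored E br by blast
  qed
  have "\<not> (ignored D i T (r, k) \<and> ignored D i T (r, k + 1))"
  proof (intro notI, elim conjE)
    assume k: "ignored D i T (r, k)" "ignored D i T (r, k + 1)"
    have "T (r, k) \<noteq> i" using ign[OF k(1), unfolded Q(1)] by auto
    moreover have "T (r, k + 1) = i" using ign[OF k(2)] Q(2) by (metis numeral_One numeral_eq_iff semiring_norm(85))
    ultimately show False using row E(1) by (auto simp: E_iff)
  qed
  with iff show "\<not> ignored D i T (r, k)" "\<not> ignored D i T (r, k + 1)" by blast+
qed

section \<open>Existence of a reachable 12-rpp\<close>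

lemma ex_descent:
  assumes adm: "admissible Q" and not_rpp: "\<not> rpp12 E Q"
  obtains r k where "(r, k) \<in> E" "(r, k + 1) \<in> E" "Q (r, k) = 2" "Q (r, k + 1) = 1"
proof -
  from not_rpp obtain r c c' where c: "(r, c) \<in> E" "(r, c') \<in> E" "c \<le> c'" "Q (r, c') < Q (r, c)"
    using admissible_table12[OF adm] unfolding rpp12_def rows_weak_def by (auto simp: not_le)
  then have less: "c < c'" by (cases "c = c'") auto
  have "Q (r, c) = 2" "Q (r, c') = 1"
    using admissible_values[OF adm c(1)] admissible_values[OF adm c(2)] c(4) by auto
  then obtain k where k: "c \<le> k" "k < c'" "Q (r, k) = 2" "Q (r, Suc k) \<noteq> 2"
    using nat_adjacent_change[OF less, of "\<lambda>k. Q (r, k) = 2"] by auto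
  \<comment> \<open>A descent needs both neighbours in \<open>E\<close>, so the row must have no
    gap: convexity puts the cell in \<open>D\<close>, and its entry in \<open>T\<close> is squeezed
    between two entries from \<open>{i, i + 1}\<close>.\<close>
  have "(r, d) \<in> E" if d: "c \<le> d" "d \<le> c'" for d
  proof -
    have "(r, d) \<in> D" using convex[of r c r c' r d] c d by (simp add: E_iff)
    moreover then have "T (r, c) \<le> T (r, d)" "T (r, d) \<le> T (r, c')"
      using row_le[of r c d] row_le[of r d c'] c d by (simp_all add: E_iff)
    ultimately show ?thesis using c by (auto simp: E_iff)
  qed
  then have "(r, k) \<in> E" "(r, k + 1) \<in> E" using k by auto
  with that k admissible_values[OF adm] show thesis by (metis Suc_eq_plus1)
qed

text \<open>By \<open>descent_not_ignored\<close> both cells are alone in their columns. These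
  columns are therefore pure, and the swap is an instance of (21).\<close>

lemma is_res_swapI:
  assumes adm: "admissible P"
    and r: "(r, k) \<in> E" "(r, k + 1) \<in> E" "P (r, k) = 2" "P (r, k + 1) = 1"
  shows "is_res E k P (P((r, k) := 1, (r, k + 1) := 2))" (is "is_res E k P ?Q")
proof -
  note nign = descent_not_ignored[OF adm r]
  note admQ = admissible_swap[OF adm r(1,2) nign r(3,4)]
  have "1 \<le> k" using r(1) col_pos[of r k] by (simp add: E_iff)
  then have "descent E P k" using r unfolding descent_def by blast
  moreover have "pure E P 2 k" "pure E P 1 (k + 1)" "pure E ?Q 1 k" "pure E ?Q 2 (k + 1)"
    using pure_not_ignored[OF r(1) nign(1), of P] pure_not_ignored[OF r(2) nign(2), of P]
      pure_not_ignored[OF r(1) nign(1), of ?Q] pure_not_ignored[OF r(2) nign(2), of ?Q] r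
    by simp_all
  moreover have "\<forall>s c. (s, c) \<in> E \<and> c \<noteq> k \<and> c \<noteq> k + 1 \<longrightarrow> ?Q (s, c) = P (s, c)" by simp
  ultimately show ?thesis
    unfolding is_res_def using admissible_benign[OF adm] admissible_benign[OF admQ]
    by (intro conjI disjI2)
qed

lemma ex_reachable_rpp12:
  assumes "admissible P"
  shows "\<exists>Q. rpp12 E Q \<and> (\<lambda>A B. \<exists>k. is_res E k A B)\<^sup>*\<^sup>* P Q"
  using assms
\<comment> \<open>Termination measure: each swap moves one 1 a single column to the left, so the sum
  of the column indices of the ones drops by one.\<close>
proof (induction "\<Sum>x\<in>{x \<in> E. P x = 1}. snd x" arbitrary: P rule: less_induct)
  case less
  show ?case
  proof (cases "rpp12 E P")
    case False
    with less.prems obtain r k where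
      r: "(r, k) \<in> E" "(r, k + 1) \<in> E" "P (r, k) = 2" "P (r, k + 1) = 1"
      by (rule ex_descent)
    define Q where "Q = P((r, k) := 1, (r, k + 1) := 2)"
    have step: "is_res E k P Q" unfolding Q_def by (rule is_res_swapI[OF less.prems r])
    have adm: "admissible Q" using less.prems step by (rule admissible_is_res)
    let ?A = "{x \<in> E. P x = 1}"
    have fin: "finite ?A" using finite_E by simp
    have "{x \<in> E. Q x = 1} = insert (r, k) (?A - {(r, k + 1)})"
      using r by (auto simp: Q_def)
    then have "(\<Sum>x\<in>{x \<in> E. Q x = 1}. snd x) = k + (\<Sum>x\<in>?A - {(r, k + 1)}. snd x)"
      using fin r by simp
    also have "\<dots> < (\<Sum>x\<in>?A. snd x)"
      using fin r sum.remove[of ?A "(r, k + 1)" snd] by simp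
    finally obtain R where "rpp12 E R" "(\<lambda>A B. \<exists>k. is_res E k A B)\<^sup>*\<^sup>* Q R"
      using less.hyps adm by blast
    with step show ?thesis by (blast intro: converse_rtranclp_into_rtranclp)
  qed blast
qed

section \<open>Comparison with the classical involution\<close>

lemma BK_free:
  assumes "c \<in> free r"
  shows "BK D i T (r, c) =
    (if card {d \<in> free r. d < c} < card (free_columns D i T r (i + 1)) then i else i + 1)"
  using assms by (simp add: BK_def free_def Let_def)

lemma BK_not_free:
  assumes "c \<notin> free r"
  shows "BK D i T (r, c) = T (r, c)"
  using assms by (simp add: BK_def free_def Let_def)

text \<open>In a sorted row the ones fill an initial segment of the free cells, whose length the
  invariant prescribes. Ignored cells carry the entries of \<open>T\<close> on both sides.\<close>

lemma sorted_admissible_eq_BK: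
  assumes adm: "admissible Q" and rpp: "rpp12 E Q" and x: "x \<in> E"
  shows "Q x = (if BK D i T x = i then 1 else 2)"
proof -
  obtain r c where rc: "x = (r, c)" by force
  show ?thesis
  proof (cases "c \<in> free r")
    case True
    have "Q (r, c) = 1 \<longleftrightarrow> card {d \<in> free r. d < c} < card {d \<in> free r. Q (r, d) = 1}"
    proof (rule initial_segment_iff_card_less[OF finite_free True])
      fix d e assume de: "d \<in> free r" "e \<in> free r" "d \<le> e" "Q (r, e) = 1"
      then have E: "(r, d) \<in> E" "(r, e) \<in> E" by (simp_all add: mem_free_iff)
      then have "Q (r, d) \<le> Q (r, e)"
        using rpp de(3) unfolding rpp12_def rows_weak_def by blast
      then show "Q (r, d) = 1" using admissible_values[OF adm E(1)] de(4) by auto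
    qed
    moreover have "card {d \<in> free r. Q (r, d) = 1} = card (free_columns D i T r (i + 1))"
      using adm unfolding admissible_def by blast
    ultimately show ?thesis
      using admissible_values[OF adm x] by (auto simp: rc BK_free[OF True])
  next
    case False
    then have "ignored D i T x" using x by (simp add: rc mem_free_iff)
    then have "Q x = (if T x = i then 1 else 2)"
      using adm T12_ignored[of x] by (metis admissible_def)
    then show ?thesis using BK_not_free[OF False] by (simp add: rc)
  qed
qed

text \<open>The description in \<open>norm12\<close> is resolved by an explicit value: every
  reachable 12-rpp equals \<open>?V\<close>, which gives uniqueness, and one exists by
  \<open>ex_reachable_rpp12\<close>.\<close>

lemma B12_eq: "B12 E T12 = (\<lambda>x\<in>E. if BK D i T x = i then 1 else 2)" (is "_ = ?V")
proof -
  have eq: "Q = ?V"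
    if "rpp12 E Q" "(\<lambda>A B. \<exists>k. is_res E k A B)\<^sup>*\<^sup>* (flip E T12) Q" for Q
  proof -
    have adm: "admissible Q"
      using admissible_reachable[OF that(2) admissible_T12_flip] .
    show ?thesis
    proof (rule extensionalityI[of _ E])
      show "Q \<in> extensional E" using adm by (auto simp: admissible_def PiE_def)
      show "Q x = ?V x" if "x \<in> E" for x
        using that sorted_admissible_eq_BK[OF adm \<open>rpp12 E Q\<close>] by simp
    qed simp
  qed
  obtain Q where "rpp12 E Q" "(\<lambda>A B. \<exists>k. is_res E k A B)\<^sup>*\<^sup>* (flip E T12) Q"
    using ex_reachable_rpp12[OF admissible_T12_flip] by blast
  with eq show ?thesis unfolding B12_def norm12_def by (intro the_equality) blast+
qed

theorem BK_eq_GBK: "BK D i T = GBK D i T"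
proof (rule ext)
  fix x :: "nat \<times> nat"
  obtain r c where x: "x = (r, c)" by force
  have G: "GBK D i T x = (if x \<in> E then (if B12 E T12 x = 1 then i else i + 1) else T x)"
    unfolding GBK_def Let_def E_def T12_def by simp
  show "BK D i T x = GBK D i T x"
  proof (cases "x \<in> E")
    case True
    \<comment> \<open>Hence coding \<open>i\<close> as 1 and everything else as 2 can be undone on
      \<open>E\<close>.\<close>
    have "BK D i T x = i \<or> BK D i T x = i + 1"
      using True by (cases "c \<in> free r") (auto simp: x BK_free BK_not_free E_iff)
    then show ?thesis using True by (auto simp: G B12_eq)
  next
    case False
    then have "c \<notin> free r" by (simp add: x mem_free_iff)
    then show ?thesis using False by (simp add: G) (simp add: x BK_not_free)
  qed
qed

end

section \<open>Skew diagrams as convex shapes\<close>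

lemma finite_diagram:
  assumes "partition lam"
  shows "finite (diagram lam)"
proof (rule finite_subset)
  have "lam r \<le> lam 1" if "1 \<le> r" for r using assms that by (simp add: partition_def)
  then show "diagram lam \<subseteq> {r. 1 \<le> r \<and> lam r \<noteq> 0} \<times> {..lam 1}"
    unfolding diagram_def by (force intro: order_trans)
  show "finite ({r. 1 \<le> r \<and> lam r \<noteq> 0} \<times> {..lam 1})"
    using assms by (simp add: partition_def)
qed

lemma diagram_down_closed:
  assumes "partition lam" "(r', c') \<in> diagram lam" "1 \<le> r" "r \<le> r'" "1 \<le> c" "c \<le> c'"
  shows "(r, c) \<in> diagram lam"
  using assms by (auto simp: partition_def diagram_def intro: order_trans)

theorem proposition6p2:
  fixes lam mu :: "nat \<Rightarrow> nat" and i :: nat and T :: "nat \<times> nat \<Rightarrow> nat"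
  assumes "skew_partition lam mu"
    and "1 \<le> i"
    and "semistandard (skew_diagram lam mu) T"
  shows "BK (skew_diagram lam mu) i T = GBK (skew_diagram lam mu) i T"
proof -
  have parts: "partition lam" "partition mu" using assms(1) by (simp_all add: skew_partition_def)
  have pos: "1 \<le> r" "1 \<le> c" if "(r, c) \<in> skew_diagram lam mu" for r c
    using that by (auto simp: skew_diagram_def diagram_def)
  interpret convex_tableau "skew_diagram lam mu" i T
  proof
    show "semistandard (skew_diagram lam mu) T" by fact
    show "finite (skew_diagram lam mu)"
      using finite_diagram[OF parts(1)] by (simp add: skew_diagram_def)
    show "1 \<le> c" if "(r, c) \<in> skew_diagram lam mu" for r c using pos that by blast
    fix r c r' c' s d
    assume *: "(r, c) \<in> skew_diagram lam mu" "(r', c') \<in> skew_diagram lam mu"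
      "r \<le> s" "s \<le> r'" "c \<le> d" "d \<le> c'"
    then have "1 \<le> r" "1 \<le> c" using pos by blast+
    \<comment> \<open>Membership in the outer diagram descends from \<open>(r', c')\<close>;
      membership in the inner one would descend to \<open>(r, c)\<close>, which lies outside
      it.\<close>
    with * show "(s, d) \<in> skew_diagram lam mu"
      using diagram_down_closed[OF parts(1), of r' c' s d]
        diagram_down_closed[OF parts(2), of s d r c]
      by (auto simp: skew_diagram_def)
  qed
  show ?thesis by (rule BK_eq_GBK)
qed

end
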